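(* Let $B$ be a nilpotent left semi-brace. Then the multiplicative group $(B,\circ)$ is a nilpotent group.
   Context: A left semi-brace is a set $B$ with two operations $+$ and $\circ$ such that $(B,+)$ is a left cancellative semigroup (not necessarily commutative), $(B,\circ)$ is a group, and $a\circ(b+c)=a\circ b+a\circ(a^-+c)$ for all $a,b,c\in B$, where $a^-$ is the inverse of $a$ in $(B,\circ)$ and $\circ$ has higher precedence than $+$. The identity of $(B,\circ)$ is denoted $0$; it is an idempotent and a left identity of $(B,+)$. Let $E$ be the set of idempotents of $(B,+)$ and $G=B+0=\{b+0: b\in B\}$, which is a subgroup of $(B,+)$ (with identity $0$). For $a,b\in B$ put $\lambda_a(b)=a\circ(a^-+b)$ and $\rho_b(a)=(a^-+b)^-\circ b$. For subsets $X,Y\subseteq B$, $X+Y=\{x+y:x\in X,y\in Y\}$. A subsemigroup $I$ of $(B,+)$ is an ideal of $B$ if: (i) $I$ is a normal subgroup of $(B,\circ)$; (ii) $I\cap G$ is a normal subgroup of $(G,+)$; (iii) $\rho_b(n)\in I$ for all $b\in B$, $n\in I\cap G$; (iv) $\lambda_g(e)\in I$ for all $g\in G$, $e\in I\cap E$. For an ideal $I$, $B/I$ is the quotient group $(B,\circ)/I$ with the induced addition (which is well defined); it is a left semi-brace. The socle of a left semi-brace $B$ is the ideal $\operatorname{Soc}(B)=\{a\in B:\rho_a=\rho_0,\ \lambda_a=\lambda_0\}$. The socle series is $\operatorname{Soc}_0(B)=\{0\}$, $\operatorname{Soc}_1(B)=\operatorname{Soc}(B)$ and, for $k>1$, $\operatorname{Soc}_k(B)$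 is the ideal of $B$ containing $\operatorname{Soc}_{k-1}(B)$ such that $\operatorname{Soc}_k(B)/\operatorname{Soc}_{k-1}(B)=\operatorname{Soc}(B/\operatorname{Soc}_{k-1}(B))$. Let $\zeta_k(B)$ be the $k$-th center of the group $(B,\circ)$ (the $k$-th term of its upper central series, $\zeta_1(B)$ being the centre). For every positive integer $k$ put $\operatorname{Ann}_k(B)=(\operatorname{Soc}_k(B)\cap\zeta_k(B))+(E\cap\zeta_k(B))$. The left semi-brace $B$ is nilpotent if $\operatorname{Ann}_n(B)=B$ for some positive integer $n$. *)

theory Defs
  imports "HOL-Algebra.Coset"
begin

definition group_center :: "('a, 'b) monoid_scheme \<Rightarrow> 'a set" where
  "group_center H = {z \<in> carrier H. \<forall>x \<in> carrier H. z \<otimes>\<^bsub>H\<^esub> x = x \<otimes>\<^bsub>H\<^esub> z}"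

primrec upper_central :: "('a, 'b) monoid_scheme \<Rightarrow> nat \<Rightarrow> 'a set" where
  "upper_central H 0 = {\<one>\<^bsub>H\<^esub>}"
| "upper_central H (Suc k) =
     {x \<in> carrier H. upper_central H k #>\<^bsub>H\<^esub> x \<in> group_center (H Mod upper_central H k)}"

definition nilpotent_group :: "('a, 'b) monoid_scheme \<Rightarrow> bool" where
  "nilpotent_group H \<longleftrightarrow> group H \<and> (\<exists>n. upper_central H n = carrier H)"

text \<open>
  The multiplicative group is the monoid part of the record, so \<open>\<otimes>\<close> is the
  operation \<open>\<circ>\<close>, \<open>inv a\<close> is the inverse with respect to \<open>\<circ>\<close>, and \<open>\<one>\<close> is the element
  usually written \<open>0\<close>. The addition is \<open>\<boxplus>\<close>, which binds weaker than \<open>\<otimes>\<close>.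
\<close>

record 'a semi_brace = "'a monoid" +
  sadd :: "['a, 'a] \<Rightarrow> 'a" (infixl "\<boxplus>\<index>" 65)

locale left_semi_brace = group B for B (structure) +
  assumes sadd_closed: "\<lbrakk>a \<in> carrier B; b \<in> carrier B\<rbrakk> \<Longrightarrow> a \<boxplus> b \<in> carrier B"
    and sadd_assoc: "\<lbrakk>a \<in> carrier B; b \<in> carrier B; c \<in> carrier B\<rbrakk>
      \<Longrightarrow> (a \<boxplus> b) \<boxplus> c = a \<boxplus> (b \<boxplus> c)"
    and sadd_left_cancel: "\<lbrakk>a \<in> carrier B; b \<in> carrier B; c \<in> carrier B; a \<boxplus> b = a \<boxplus> c\<rbrakk>
      \<Longrightarrow> b = c"
    and mult_sadd: "\<lbrakk>a \<in> carrier B; b \<in> carrier B; c \<in> carrier B\<rbrakk>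
      \<Longrightarrow> a \<otimes> (b \<boxplus> c) = a \<otimes> b \<boxplus> a \<otimes> (inv a \<boxplus> c)"

definition sadd_idem :: "('a, 'b) semi_brace_scheme \<Rightarrow> 'a set" where
  "sadd_idem B = {e \<in> carrier B. e \<boxplus>\<^bsub>B\<^esub> e = e}"

definition sadd_group :: "('a, 'b) semi_brace_scheme \<Rightarrow> 'a monoid" where
  "sadd_group B = \<lparr>carrier = {b \<boxplus>\<^bsub>B\<^esub> \<one>\<^bsub>B\<^esub> | b. b \<in> carrier B}, mult = sadd B, one = \<one>\<^bsub>B\<^esub>\<rparr>"

definition sb_lambda :: "('a, 'b) semi_brace_scheme \<Rightarrow> 'a \<Rightarrow> 'a \<Rightarrow> 'a" where
  "sb_lambda B a b = a \<otimes>\<^bsub>B\<^esub> (inv\<^bsub>B\<^esub> a \<boxplus>\<^bsub>B\<^esub> b)"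

text \<open>The subscript comes first: \<open>sb_rho B b a\<close> is \<open>\<rho>\<^sub>b(a)\<close>.\<close>

definition sb_rho :: "('a, 'b) semi_brace_scheme \<Rightarrow> 'a \<Rightarrow> 'a \<Rightarrow> 'a" where
  "sb_rho B b a = inv\<^bsub>B\<^esub> (inv\<^bsub>B\<^esub> a \<boxplus>\<^bsub>B\<^esub> b) \<otimes>\<^bsub>B\<^esub> b"

definition sb_ideal :: "('a, 'b) semi_brace_scheme \<Rightarrow> 'a set \<Rightarrow> bool" where
  "sb_ideal B I \<longleftrightarrow>
     (\<forall>x \<in> I. \<forall>y \<in> I. x \<boxplus>\<^bsub>B\<^esub> y \<in> I) \<and>
     I \<lhd> B \<and>
     I \<inter> carrier (sadd_group B) \<lhd> sadd_group B \<and>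
     (\<forall>b \<in> carrier B. \<forall>n \<in> I \<inter> carrier (sadd_group B). sb_rho B b n \<in> I) \<and>
     (\<forall>g \<in> carrier (sadd_group B). \<forall>e \<in> I \<inter> sadd_idem B. sb_lambda B g e \<in> I)"

text \<open>
  The sum of two cosets is the union of the cosets of all sums of representatives (in the
  style of \<open>rcoset_mult\<close> for ring quotients). For an ideal this union is a single coset.
\<close>

definition sb_quotient :: "('a, 'b) semi_brace_scheme \<Rightarrow> 'a set \<Rightarrow> 'a set semi_brace" where
  "sb_quotient B I =
     \<lparr>carrier = carrier (B Mod I), mult = mult (B Mod I), one = one (B Mod I),
      sadd = (\<lambda>X Y. \<Union>x\<in>X. \<Union>y\<in>Y. I #>\<^bsub>B\<^esub> (x \<boxplus>\<^bsub>B\<^esub> y))\<rparr>"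

definition Soc :: "('a, 'b) semi_brace_scheme \<Rightarrow> 'a set" where
  "Soc B = {a \<in> carrier B.
     (\<forall>x \<in> carrier B. sb_rho B a x = sb_rho B \<one>\<^bsub>B\<^esub> x) \<and>
     (\<forall>x \<in> carrier B. sb_lambda B a x = sb_lambda B \<one>\<^bsub>B\<^esub> x)}"

text \<open>The image of \<open>I\<close> below is the quotient of \<open>I\<close> by the preceding term.\<close>

fun Soc_series :: "('a, 'b) semi_brace_scheme \<Rightarrow> nat \<Rightarrow> 'a set" where
  "Soc_series B 0 = {\<one>\<^bsub>B\<^esub>}"
| "Soc_series B (Suc 0) = Soc B"
| "Soc_series B (Suc (Suc k)) =
     (THE I. sb_ideal B I \<and> Soc_series B (Suc k) \<subseteq> I \<and>
        (\<lambda>x. Soc_series B (Suc k) #>\<^bsub>B\<^esub> x) ` I = Soc (sb_quotient B (Soc_series B (Suc k))))"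

definition Ann_series :: "('a, 'b) semi_brace_scheme \<Rightarrow> nat \<Rightarrow> 'a set" where
  "Ann_series B k =
     {x \<boxplus>\<^bsub>B\<^esub> y | x y. x \<in> Soc_series B k \<inter> upper_central B k \<and>
                    y \<in> sadd_idem B \<inter> upper_central B k}"

definition nilpotent_semi_brace :: "('a, 'b) semi_brace_scheme \<Rightarrow> bool" where
  "nilpotent_semi_brace B \<longleftrightarrow> left_semi_brace B \<and> (\<exists>n>0. Ann_series B n = carrier B)"

end

theory Submission
  imports Defs
begin

text \<open>
  Write \<open>E\<close> for the set of additive idempotents and \<open>Z\<close> for the \<open>n\<close>-th centre of the
  multiplicative group, where every element of the semi-brace has the form \<open>x + y\<close> with
  \<open>x \<in> Soc\<^sub>n \<inter> Z\<close> and \<open>y \<in> E \<inter> Z\<close>. Elements of \<open>E\<close> are left identities for the addition.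
  Hence, if \<open>x + y\<close> itself is idempotent, then adding \<open>0\<close> on the right gives \<open>x + 0 = 0\<close>,
  so \<open>x\<close> is idempotent and \<open>x + y = y \<in> Z\<close>. This shows \<open>E \<subseteq> Z\<close>.

  On the other hand \<open>a + b = a \<circ> \<lambda>\<^bsub>a\<^sup>-\<^esub>(b)\<close>, and each \<open>\<lambda>\<^sub>a\<close> is an additive endomorphism, so
  that it maps \<open>E\<close> into itself. Therefore \<open>x + y\<close> is the product of \<open>x \<in> Z\<close> and an element of
  \<open>E \<subseteq> Z\<close>. As \<open>Z\<close> is a subgroup, the whole group equals \<open>Z\<close>.
\<close>

lemma (in group) group_center_normal: "group_center G \<lhd> G"
proof (rule normal_invI)
  have carr: "z \<in> carrier G" if "z \<in> group_center G" for z
    using that by (simp add: group_center_def)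
  have comm: "z \<otimes> x = x \<otimes> z" if "z \<in> group_center G" "x \<in> carrier G" for z x
    using that unfolding group_center_def by blast
  have centerI: "z \<in> group_center G"
    if "z \<in> carrier G" "\<And>x. x \<in> carrier G \<Longrightarrow> z \<otimes> x = x \<otimes> z" for z
    using that unfolding group_center_def by blast
  show "subgroup (group_center G) G"
  proof (rule subgroupI)
    have "\<one> \<in> group_center G" by (rule centerI) simp_all
    then show "group_center G \<noteq> {}" by blast
  next
    fix a assume a: "a \<in> group_center G"
    show "inv a \<in> group_center G"
    proof (rule centerI)
      fix x assume x: "x \<in> carrier G"
      have "inv a \<otimes> x = inv (inv x \<otimes> a)" using carr[OF a] x by (simp add: inv_mult_group)
      also have "inv x \<otimes> a = a \<otimes> inv x" using comm[OF a, of "inv x"] x by simp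
      also have "inv (a \<otimes> inv x) = x \<otimes> inv a" using carr[OF a] x by (simp add: inv_mult_group)
      finally show "inv a \<otimes> x = x \<otimes> inv a" .
    qed (simp add: carr[OF a])
  next
    fix a b assume a: "a \<in> group_center G" and b: "b \<in> group_center G"
    show "a \<otimes> b \<in> group_center G"
    proof (rule centerI)
      fix x assume x: "x \<in> carrier G"
      have "a \<otimes> b \<otimes> x = a \<otimes> (x \<otimes> b)"
        using carr[OF a] carr[OF b] x comm[OF b x] by (simp add: m_assoc)
      also have "\<dots> = x \<otimes> a \<otimes> b"
        using carr[OF a] carr[OF b] x comm[OF a x] by (simp flip: m_assoc)
      also have "\<dots> = x \<otimes> (a \<otimes> b)"
        using carr[OF a] carr[OF b] x by (simp add: m_assoc)
      finally show "a \<otimes> b \<otimes> x = x \<otimes> (a \<otimes> b)" .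
    qed (simp add: carr a b)
  qed (auto simp: group_center_def)
  fix x h assume x: "x \<in> carrier G" and h: "h \<in> group_center G"
  have "x \<otimes> h \<otimes> inv x = h"
    using x carr[OF h] by (simp add: m_assoc flip: comm[OF h x])
  then show "x \<otimes> h \<otimes> inv x \<in> group_center G" using h by simp
qed

text \<open>Normality is what makes the quotient in the next step of the recursion a group.\<close>

lemma (in group) upper_central_normal: "upper_central G k \<lhd> G"
proof (induction k)
  case 0
  then show ?case using one_is_normal by simp
next
  case (Suc k)
  let ?N = "upper_central G k"
  interpret N: normal ?N G by fact
  interpret Q: group "G Mod ?N" by (rule N.factorgroup_is_group)
  interpret pr: group_hom G "G Mod ?N" "\<lambda>x. ?N #> x"
    by unfold_locales (rule N.r_coset_hom_Mod)
  interpret Z: normal "group_center (G Mod ?N)" "G Mod ?N"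
    by (rule Q.group_center_normal)
  show ?case
  proof (rule normal_invI)
    show "subgroup (upper_central G (Suc k)) G"
    proof (rule subgroupI)
      show "upper_central G (Suc k) \<noteq> {}"
        using Z.one_closed pr.hom_one one_closed by (auto intro!: exI[of _ \<one>])
    next
      fix a b assume "a \<in> upper_central G (Suc k)" "b \<in> upper_central G (Suc k)"
      then show "a \<otimes> b \<in> upper_central G (Suc k)"
        using Z.m_closed[of "?N #> a" "?N #> b"] by (simp flip: N.rcos_sum)
    next
      fix a assume "a \<in> upper_central G (Suc k)"
      then show "inv a \<in> upper_central G (Suc k)"
        using Z.m_inv_closed[of "?N #> a"] by simp
    qed auto
  next
    fix x h assume "x \<in> carrier G" "h \<in> upper_central G (Suc k)"
    then show "x \<otimes> h \<otimes> inv x \<in> upper_central G (Suc k)"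
      using Z.inv_op_closed2[of "?N #> x" "?N #> h"] by simp
  qed
qed

context left_semi_brace
begin

lemma sb_lambda_closed [simp]:
  "\<lbrakk>a \<in> carrier B; b \<in> carrier B\<rbrakk> \<Longrightarrow> sb_lambda B a b \<in> carrier B"
  by (simp add: sb_lambda_def sadd_closed)

lemma sadd_eq_mult_lambda:
  assumes "a \<in> carrier B" "b \<in> carrier B"
  shows "a \<boxplus> b = a \<otimes> sb_lambda B (inv a) b"
  using assms by (simp add: sb_lambda_def sadd_closed m_assoc[symmetric])

lemma sb_lambda_sadd:
  assumes a: "a \<in> carrier B" and b: "b \<in> carrier B" and c: "c \<in> carrier B"
  shows "sb_lambda B a (b \<boxplus> c) = sb_lambda B a b \<boxplus> sb_lambda B a c"
proof -
  have "sb_lambda B a (b \<boxplus> c) = a \<otimes> ((inv a \<boxplus> b) \<boxplus> c)"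
    using assms by (simp add: sb_lambda_def sadd_assoc)
  also have "\<dots> = sb_lambda B a b \<boxplus> sb_lambda B a c"
    using mult_sadd[OF a _ c, of "inv a \<boxplus> b"] assms by (simp add: sb_lambda_def sadd_closed)
  finally show ?thesis .
qed

lemma sb_lambda_idem:
  "\<lbrakk>a \<in> carrier B; e \<in> sadd_idem B\<rbrakk> \<Longrightarrow> sb_lambda B a e \<in> sadd_idem B"
  using sb_lambda_sadd[of a e e] by (auto simp: sadd_idem_def)

lemma one_sadd_idem: "\<one> \<in> sadd_idem B"
proof -
  have "\<one> \<boxplus> \<one> = \<one> \<boxplus> (\<one> \<boxplus> \<one>)"
    using mult_sadd[of \<one> \<one> \<one>] by (simp add: sadd_closed)
  then have "\<one> = \<one> \<boxplus> \<one>"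
    using sadd_left_cancel[of \<one> \<one> "\<one> \<boxplus> \<one>"] by (simp add: sadd_closed)
  then show ?thesis by (simp add: sadd_idem_def)
qed

lemma idem_sadd:
  assumes "e \<in> sadd_idem B" "b \<in> carrier B"
  shows "e \<boxplus> b = b"
  using assms sadd_left_cancel[of e "e \<boxplus> b" b] sadd_assoc[of e e b]
  by (simp add: sadd_idem_def sadd_closed)

lemma sadd_idem_iff:
  assumes x: "x \<in> carrier B"
  shows "x \<in> sadd_idem B \<longleftrightarrow> x \<boxplus> \<one> = \<one>"
proof
  assume "x \<boxplus> \<one> = \<one>"
  then have "x \<boxplus> (\<one> \<boxplus> x) = \<one> \<boxplus> x"
    using x sadd_assoc[of x \<one> x] by simp
  then show "x \<in> sadd_idem B"
    using x idem_sadd[OF one_sadd_idem x] by (simp add: sadd_idem_def)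
qed (simp add: idem_sadd)

lemma idem_sadd_cancel_right:
  assumes x: "x \<in> carrier B" and y: "y \<in> sadd_idem B" and xy: "x \<boxplus> y \<in> sadd_idem B"
  shows "x \<boxplus> y = y"
proof -
  have yc: "y \<in> carrier B" using y by (simp add: sadd_idem_def)
  have "x \<boxplus> \<one> = x \<boxplus> (y \<boxplus> \<one>)" using y by (simp add: idem_sadd)
  also have "\<dots> = \<one>" using sadd_assoc[OF x yc, of \<one>] xy by (simp add: idem_sadd)
  finally have "x \<in> sadd_idem B" using x by (simp add: sadd_idem_iff)
  then show ?thesis using yc by (rule idem_sadd)
qed

text \<open>
  This is the core of the argument: applied to \<open>Z\<close> the \<open>n\<close>-th centre it yields the theorem,
  since the first summand lies in \<open>Z\<close> by definition of the annihilator series.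
\<close>

lemma subgroup_eq_carrier_if_sadd_idem_decomp:
  assumes Z: "subgroup Z B"
    and decomp: "\<And>b. b \<in> carrier B \<Longrightarrow> \<exists>x\<in>Z. \<exists>y\<in>sadd_idem B \<inter> Z. b = x \<boxplus> y"
  shows "Z = carrier B"
proof
  show "Z \<subseteq> carrier B" using Z by (rule subgroup.subset)
  have E: "sadd_idem B \<subseteq> Z"
  proof
    fix e assume e: "e \<in> sadd_idem B"
    then obtain x y where "x \<in> Z" "y \<in> sadd_idem B \<inter> Z" "e = x \<boxplus> y"
      using decomp[of e] by (auto simp: sadd_idem_def)
    then show "e \<in> Z"
      using e idem_sadd_cancel_right[of x y] subgroup.mem_carrier[OF Z] by auto
  qed
  show "carrier B \<subseteq> Z"
  proof
    fix b assume "b \<in> carrier B"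
    then obtain x y where x: "x \<in> Z" and y: "y \<in> sadd_idem B" and b: "b = x \<boxplus> y"
      using decomp by blast
    have xc: "x \<in> carrier B" using Z x by (rule subgroup.mem_carrier)
    have "sb_lambda B (inv x) y \<in> Z" using E sb_lambda_idem[OF inv_closed[OF xc] y] by blast
    then have "x \<otimes> sb_lambda B (inv x) y \<in> Z" using Z x by (simp add: subgroup.m_closed)
    then show "b \<in> Z"
      using b xc y sadd_eq_mult_lambda[of x y] by (simp add: sadd_idem_def)
  qed
qed

end

theorem theorem53:
  fixes B :: "('a, 'b) semi_brace_scheme"
  assumes "left_semi_brace B"
    and "nilpotent_semi_brace B"
  shows "nilpotent_group B"
proof -
  interpret left_semi_brace B by fact
  obtain n where n: "Ann_series B n = carrier B"
    using assms(2) by (auto simp: nilpotent_semi_brace_def)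
  have "subgroup (upper_central B n) B"
    using upper_central_normal by (rule normal_imp_subgroup)
  then have "upper_central B n = carrier B"
  proof (rule subgroup_eq_carrier_if_sadd_idem_decomp)
    fix b assume "b \<in> carrier B"
    then show "\<exists>x\<in>upper_central B n. \<exists>y\<in>sadd_idem B \<inter> upper_central B n. b = x \<boxplus>\<^bsub>B\<^esub> y"
      unfolding n[symmetric] Ann_series_def by blast
  qed
  then show ?thesis
    using is_group by (auto simp: nilpotent_group_def)
qed

end
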